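(* Let $\mathbb K$ be a field of characteristic $0$, let $(A,*,\{\,,\,,\},\alpha)$ be a (multiplicative) Hom-Lie-Yamaguti algebra over $\mathbb K$, and let $\beta: A\to A$ be an endomorphism of the algebra $(A,*,\{\,,\,,\})$ such that $\beta\alpha=\alpha\beta$. Define on $A$ the operations $$x *_{\beta} y := \beta(x*y),\qquad \{x,y,z\}_{\beta} := \beta^{2}(\{x,y,z\})$$ for all $x,y,z\in A$. Then $(A, *_{\beta}, \{\,,\,,\}_{\beta}, \beta\alpha)$ is a (multiplicative) Hom-Lie-Yamaguti algebra.
   Context: An endomorphism of $(A,*,\{\,,\,,\})$ is a $\mathbb K$-linear map $\beta:A\to A$ with $\beta(x*y)=\beta(x)*\beta(y)$ and $\beta(\{x,y,z\})=\{\beta(x),\beta(y),\beta(z)\}$ for all $x,y,z\in A$. Powers and juxtaposition of maps denote composition. A Hom-Lie-Yamaguti algebra (Hom-LY algebra) is a quadruple $(L,*,\{\,,\,,\},\alpha)$ in which $L$ is a $\mathbb K$-vector space, $*$ is a bilinear binary operation on $L$, $\{\,,\,,\}$ is a trilinear ternary operation on $L$, and $\alpha:L\to L$ is a linear map, such that for all $u,v,w,x,y,z\in L$ (with $\sigma$ denoting the sum over cyclic permutations of $x,y,z$): (B1) $\alpha(x*y)=\alpha(x)*\alpha(y)$; (B2) $\alpha(\{x,y,z\})=\{\alpha(x),\alpha(y),\alpha(z)\}$; (B3) $x*y=-y*x$; (B4) $\{x,y,z\}=-\{y,x,z\}$; (B5) $\sigma[(x*y)*\alpha(z)+\{x,y,z\}]=0$;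 (B6) $\sigma[\{x*y,\alpha(z),\alpha(u)\}+\{z*y,\alpha(x),\alpha(u)\}]=0$; (B7) $\{\alpha(x),\alpha(y),u*v\}=\{x,y,u\}*\alpha^{2}(v)+\alpha^{2}(u)*\{x,y,v\}$; (B8) $\{\alpha^{2}(x),\alpha^{2}(y),\{\alpha^{2}(u),\alpha^{2}(v),w\}\}=\{\{x,y,\alpha^{2}(u)\},\alpha^{4}(v),\alpha^{2}(w)\}+\{\alpha^{4}(u),\{x,y,\alpha^{2}(v)\},\alpha^{2}(w)\}+\{\alpha^{4}(u),\alpha^{4}(v),\{x,y,w\}\}$. Multiplicativity of a Hom-LY algebra means exactly conditions (B1) and (B2), so it is part of the definition. *)

theory Defs
  imports Complex_Main
begin

definition cyclic_sum :: "('a \<Rightarrow> 'a \<Rightarrow> 'a \<Rightarrow> 'a::ab_group_add) \<Rightarrow> 'a \<Rightarrow> 'a \<Rightarrow> 'a \<Rightarrow> 'a"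
  where "cyclic_sum f x y z = f x y z + f y z x + f z x y"

definition bilinear_op :: "('k::field \<Rightarrow> 'a \<Rightarrow> 'a::ab_group_add) \<Rightarrow> ('a \<Rightarrow> 'a \<Rightarrow> 'a) \<Rightarrow> bool"
  where "bilinear_op scale m \<longleftrightarrow>
    (\<forall>y. Vector_Spaces.linear scale scale (\<lambda>x. m x y)) \<and>
    (\<forall>x. Vector_Spaces.linear scale scale (\<lambda>y. m x y))"

definition trilinear_op :: "('k::field \<Rightarrow> 'a \<Rightarrow> 'a::ab_group_add) \<Rightarrow> ('a \<Rightarrow> 'a \<Rightarrow> 'a \<Rightarrow> 'a) \<Rightarrow> bool"
  where "trilinear_op scale t \<longleftrightarrow>
    (\<forall>y z. Vector_Spaces.linear scale scale (\<lambda>x. t x y z)) \<and>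
    (\<forall>x z. Vector_Spaces.linear scale scale (\<lambda>y. t x y z)) \<and>
    (\<forall>x y. Vector_Spaces.linear scale scale (\<lambda>z. t x y z))"

text \<open>The underlying vector space is the whole type \<open>'a\<close> with scalar multiplication \<open>scale\<close>.
  Multiplicativity (\<open>alpha_mult\<close>, \<open>alpha_ternary\<close>) is part of the definition.
  The summand \<open>t (m z y) (\<alpha> x) (\<alpha> u)\<close> in \<open>ternary_cyclic\<close> is kept, although \<open>mult_skew\<close> makes
  the two summands cancel in the cyclic sum.\<close>

locale hom_ly_algebra = vector_space scale
  for scale :: "'k::field \<Rightarrow> 'a::ab_group_add \<Rightarrow> 'a" +
  fixes m :: "'a \<Rightarrow> 'a \<Rightarrow> 'a"
    and t :: "'a \<Rightarrow> 'a \<Rightarrow> 'a \<Rightarrow> 'a"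
    and \<alpha> :: "'a \<Rightarrow> 'a"
  assumes bilinear: "bilinear_op scale m"
    and trilinear: "trilinear_op scale t"
    and linear_alpha: "Vector_Spaces.linear scale scale \<alpha>"
    and alpha_mult: "\<And>x y. \<alpha> (m x y) = m (\<alpha> x) (\<alpha> y)"
    and alpha_ternary: "\<And>x y z. \<alpha> (t x y z) = t (\<alpha> x) (\<alpha> y) (\<alpha> z)"
    and mult_skew: "\<And>x y. m x y = - m y x"
    and ternary_skew: "\<And>x y z. t x y z = - t y x z"
    and mult_ternary_cyclic:
      "\<And>x y z. cyclic_sum (\<lambda>x y z. m (m x y) (\<alpha> z) + t x y z) x y z = 0"
    and ternary_cyclic:
      "\<And>x y z u. cyclic_sum (\<lambda>x y z. t (m x y) (\<alpha> z) (\<alpha> u) + t (m z y) (\<alpha> x) (\<alpha> u)) x y z = 0"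
    and ternary_mult:
      "\<And>x y u v. t (\<alpha> x) (\<alpha> y) (m u v)
         = m (t x y u) ((\<alpha> ^^ 2) v) + m ((\<alpha> ^^ 2) u) (t x y v)"
    and ternary_ternary:
      "\<And>x y u v w. t ((\<alpha> ^^ 2) x) ((\<alpha> ^^ 2) y) (t ((\<alpha> ^^ 2) u) ((\<alpha> ^^ 2) v) w)
         = t (t x y ((\<alpha> ^^ 2) u)) ((\<alpha> ^^ 4) v) ((\<alpha> ^^ 2) w)
           + t ((\<alpha> ^^ 4) u) (t x y ((\<alpha> ^^ 2) v)) ((\<alpha> ^^ 2) w)
           + t ((\<alpha> ^^ 4) u) ((\<alpha> ^^ 4) v) (t x y w)"

definition ly_endomorphism ::
    "('k::field \<Rightarrow> 'a \<Rightarrow> 'a::ab_group_add) \<Rightarrow> ('a \<Rightarrow> 'a \<Rightarrow> 'a) \<Rightarrow> ('a \<Rightarrow> 'a \<Rightarrow> 'a \<Rightarrow> 'a) \<Rightarrow> ('a \<Rightarrow> 'a) \<Rightarrow> bool"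
  where "ly_endomorphism scale m t \<beta> \<longleftrightarrow>
    Vector_Spaces.linear scale scale \<beta> \<and>
    (\<forall>x y. \<beta> (m x y) = m (\<beta> x) (\<beta> y)) \<and>
    (\<forall>x y z. \<beta> (t x y z) = t (\<beta> x) (\<beta> y) (\<beta> z))"

end

theory Submission imports Defs begin

text \<open>Each identity of the twisted algebra is the image under a power of \<open>\<beta>\<close> of an instance
  of the corresponding identity of the original one. Since \<open>\<beta>\<close> is an endomorphism commuting with
  \<open>\<alpha>\<close>, all factors \<open>\<beta>\<close> in a term can be pushed down to the variables. A variable then
  receives one factor from each binary product enclosing it, two from each ternary product, and
  one from each \<open>\<alpha>\<close> applied to it. The definition of a Hom-Lie-Yamaguti algebra is
  homogeneous for this count: in \<open>mult_ternary_cyclic\<close> every variable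
  receives two factors, and in \<open>ternary_cyclic\<close> and \<open>ternary_mult\<close> three, so these
  identities are the images of the original ones under \<open>\<beta>\<^sup>2\<close> and \<open>\<beta>\<^sup>3\<close>.

  In \<open>ternary_ternary\<close> the count is six for \<open>u\<close> and \<open>v\<close> but four for \<open>x\<close>, \<open>y\<close> and \<open>w\<close>, in each
  of the four terms. That identity is therefore the image under \<open>\<beta>\<^sup>4\<close> of the original one at
  \<open>x, y, \<beta>\<^sup>2 u, \<beta>\<^sup>2 v, w\<close>.\<close>

lemma bilinear_op_compose:
  assumes "bilinear_op scale m" and "Vector_Spaces.linear scale scale f"
  shows "bilinear_op scale (\<lambda>x y. f (m x y))"
  using assms Vector_Spaces.linear_compose[of scale scale _ scale f]
  unfolding bilinear_op_def comp_def by blast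

lemma trilinear_op_compose:
  assumes "trilinear_op scale t" and "Vector_Spaces.linear scale scale f"
  shows "trilinear_op scale (\<lambda>x y z. f (t x y z))"
  using assms Vector_Spaces.linear_compose[of scale scale _ scale f]
  unfolding trilinear_op_def comp_def by blast

theorem theorem3p1:
  fixes scale :: "'k::field_char_0 \<Rightarrow> 'a::ab_group_add \<Rightarrow> 'a"
    and m :: "'a \<Rightarrow> 'a \<Rightarrow> 'a"
    and t :: "'a \<Rightarrow> 'a \<Rightarrow> 'a \<Rightarrow> 'a"
    and \<alpha> \<beta> :: "'a \<Rightarrow> 'a"
  assumes "hom_ly_algebra scale m t \<alpha>"
    and "ly_endomorphism scale m t \<beta>"
    and "\<beta> \<circ> \<alpha> = \<alpha> \<circ> \<beta>"
  shows "hom_ly_algebra scale (\<lambda>x y. \<beta> (m x y)) (\<lambda>x y z. (\<beta> ^^ 2) (t x y z)) (\<beta> \<circ> \<alpha>)"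
proof -
  interpret A: hom_ly_algebra scale m t \<alpha> by (fact assms(1))
  have lin: "Vector_Spaces.linear scale scale \<beta>"
    and \<beta>_mult: "\<And>x y. \<beta> (m x y) = m (\<beta> x) (\<beta> y)"
    and \<beta>_ternary: "\<And>x y z. \<beta> (t x y z) = t (\<beta> x) (\<beta> y) (\<beta> z)"
    using assms(2) by (auto simp: ly_endomorphism_def)
  have comm: "\<alpha> (\<beta> x) = \<beta> (\<alpha> x)" for x
    using assms(3) by (metis comp_apply)
  interpret \<beta>: Vector_Spaces.linear scale scale \<beta> by (fact lin)
  have lin2: "Vector_Spaces.linear scale scale (\<beta> ^^ 2)"
    using Vector_Spaces.linear_compose[OF lin lin] by (simp add: numeral_eq_Suc)
  \<comment> \<open>Oriented to move \<open>\<beta>\<close> outwards, so that an identity becomes a power of \<open>\<beta>\<close> applied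
    to the original one.\<close>
  note pull_out = \<beta>_mult[symmetric] \<beta>_ternary[symmetric] \<beta>.add[symmetric] comm
  show ?thesis
  proof (intro hom_ly_algebra.intro hom_ly_algebra_axioms.intro)
    show "vector_space scale" by (fact A.vector_space_axioms)
    show "bilinear_op scale (\<lambda>x y. \<beta> (m x y))"
      by (rule bilinear_op_compose[OF A.bilinear lin])
    show "trilinear_op scale (\<lambda>x y z. (\<beta> ^^ 2) (t x y z))"
      by (rule trilinear_op_compose[OF A.trilinear lin2])
    show "Vector_Spaces.linear scale scale (\<beta> \<circ> \<alpha>)"
      by (rule Vector_Spaces.linear_compose[OF A.linear_alpha lin])
  next
    fix x y z u v w
    show "(\<beta> \<circ> \<alpha>) (\<beta> (m x y)) = \<beta> (m ((\<beta> \<circ> \<alpha>) x) ((\<beta> \<circ> \<alpha>) y))"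
      by (simp add: pull_out A.alpha_mult)
    show "(\<beta> \<circ> \<alpha>) ((\<beta> ^^ 2) (t x y z))
        = (\<beta> ^^ 2) (t ((\<beta> \<circ> \<alpha>) x) ((\<beta> \<circ> \<alpha>) y) ((\<beta> \<circ> \<alpha>) z))"
      by (simp add: numeral_eq_Suc pull_out A.alpha_ternary)
    show "\<beta> (m x y) = - \<beta> (m y x)"
      using A.mult_skew[of x y] \<beta>.neg by metis
    show "(\<beta> ^^ 2) (t x y z) = - (\<beta> ^^ 2) (t y x z)"
      using A.ternary_skew[of x y z] \<beta>.neg by (simp add: numeral_eq_Suc)
    have "cyclic_sum (\<lambda>x y z. \<beta> (m (\<beta> (m x y)) ((\<beta> \<circ> \<alpha>) z)) + (\<beta> ^^ 2) (t x y z)) x y z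
        = (\<beta> ^^ 2) (cyclic_sum (\<lambda>x y z. m (m x y) (\<alpha> z) + t x y z) x y z)"
      by (simp add: cyclic_sum_def numeral_eq_Suc pull_out)
    then show "cyclic_sum (\<lambda>x y z. \<beta> (m (\<beta> (m x y)) ((\<beta> \<circ> \<alpha>) z)) + (\<beta> ^^ 2) (t x y z)) x y z = 0"
      by (simp add: A.mult_ternary_cyclic numeral_eq_Suc)
    have "cyclic_sum (\<lambda>x y z. (\<beta> ^^ 2) (t (\<beta> (m x y)) ((\<beta> \<circ> \<alpha>) z) ((\<beta> \<circ> \<alpha>) u))
            + (\<beta> ^^ 2) (t (\<beta> (m z y)) ((\<beta> \<circ> \<alpha>) x) ((\<beta> \<circ> \<alpha>) u))) x y z
        = (\<beta> ^^ 3) (cyclic_sum (\<lambda>x y z. t (m x y) (\<alpha> z) (\<alpha> u) + t (m z y) (\<alpha> x) (\<alpha> u)) x y z)"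
      by (simp add: cyclic_sum_def numeral_eq_Suc pull_out)
    then show "cyclic_sum (\<lambda>x y z. (\<beta> ^^ 2) (t (\<beta> (m x y)) ((\<beta> \<circ> \<alpha>) z) ((\<beta> \<circ> \<alpha>) u))
            + (\<beta> ^^ 2) (t (\<beta> (m z y)) ((\<beta> \<circ> \<alpha>) x) ((\<beta> \<circ> \<alpha>) u))) x y z = 0"
      by (simp add: A.ternary_cyclic numeral_eq_Suc)
    show "(\<beta> ^^ 2) (t ((\<beta> \<circ> \<alpha>) x) ((\<beta> \<circ> \<alpha>) y) (\<beta> (m u v)))
        = \<beta> (m ((\<beta> ^^ 2) (t x y u)) (((\<beta> \<circ> \<alpha>) ^^ 2) v))
          + \<beta> (m (((\<beta> \<circ> \<alpha>) ^^ 2) u) ((\<beta> ^^ 2) (t x y v)))"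
      using arg_cong[OF A.ternary_mult[of x y u v], of "\<beta> ^^ 3"]
      by (simp add: numeral_eq_Suc pull_out)
    show "(\<beta> ^^ 2) (t (((\<beta> \<circ> \<alpha>) ^^ 2) x) (((\<beta> \<circ> \<alpha>) ^^ 2) y)
            ((\<beta> ^^ 2) (t (((\<beta> \<circ> \<alpha>) ^^ 2) u) (((\<beta> \<circ> \<alpha>) ^^ 2) v) w)))
        = (\<beta> ^^ 2) (t ((\<beta> ^^ 2) (t x y (((\<beta> \<circ> \<alpha>) ^^ 2) u))) (((\<beta> \<circ> \<alpha>) ^^ 4) v) (((\<beta> \<circ> \<alpha>) ^^ 2) w))
          + (\<beta> ^^ 2) (t (((\<beta> \<circ> \<alpha>) ^^ 4) u) ((\<beta> ^^ 2) (t x y (((\<beta> \<circ> \<alpha>) ^^ 2) v))) (((\<beta> \<circ> \<alpha>) ^^ 2) w))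
          + (\<beta> ^^ 2) (t (((\<beta> \<circ> \<alpha>) ^^ 4) u) (((\<beta> \<circ> \<alpha>) ^^ 4) v) ((\<beta> ^^ 2) (t x y w)))"
      \<comment> \<open>The substitution of \<open>\<beta>\<^sup>2 u\<close> and \<open>\<beta>\<^sup>2 v\<close> accounts for the two extra factors on \<open>u\<close> and \<open>v\<close>.\<close>
      using arg_cong[OF A.ternary_ternary[of x y "(\<beta> ^^ 2) u" "(\<beta> ^^ 2) v" w], of "\<beta> ^^ 4"]
      by (simp add: numeral_eq_Suc pull_out)
  qed
qed

end
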